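(* Let $n$ be a positive integer. The mapping $[\mathbb{R}^n]\times(0,+\infty)\to[\mathbb{R}^n]$, $(A,\lambda)\mapsto\lambda A$, is not continuous in $\lambda$; that is, there exists a metric space $A$ with $d_{GH}(A,\mathbb{R}^n)<\infty$ such that the map $\lambda\mapsto\lambda A$, $\lambda\in(0,+\infty)$, is not continuous with respect to the Gromov--Hausdorff distance.
   Context: All metric spaces are non-empty, and $\mathbb{R}^n$ carries the Euclidean metric. For metric spaces $X,Y$, $d_{GH}(X,Y)\in[0,\infty]$ is the Gromov--Hausdorff distance: the infimum of the numbers $r\ge 0$ such that there exist a metric space $Z$ and subsets $X',Y'\subset Z$ isometric to $X$ and $Y$ respectively with Hausdorff distance $d_H(X',Y')\le r$ (it may be infinite). The cloud $[\mathbb{R}^n]$ is the class of all metric spaces $A$ with $d_{GH}(A,\mathbb{R}^n)<\infty$, considered up to zero Gromov--Hausdorff distance. For a metric space $(A,d_A)$ and $\lambda>0$, $\lambda A$ denotes the metric space $(A,\lambda d_A)$. The map $\lambda\mapsto\lambda A$ is continuous at $\lambda_0>0$ with respect to the Gromov--Hausdorff distance if $d_{GH}(\lambda A,\lambda_0A)\to0$ as $\lambda\to\lambda_0$, and it is continuous if it is continuous at every $\lambda_0>0$. *)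

theory Defs
  imports "HOL-Analysis.Analysis"
begin

definition hausdorff_dist :: "'a metric \<Rightarrow> 'a set \<Rightarrow> 'a set \<Rightarrow> ennreal" where
  "hausdorff_dist Z X Y =
     max (SUP x\<in>X. INF y\<in>Y. ennreal (mdist Z x y)) (SUP y\<in>Y. INF x\<in>X. ennreal (mdist Z x y))"

definition isometric :: "'a metric \<Rightarrow> 'b metric \<Rightarrow> bool" where
  "isometric X Y \<longleftrightarrow> (\<exists>f. bij_betw f (mspace X) (mspace Y) \<and>
     (\<forall>x\<in>mspace X. \<forall>y\<in>mspace X. mdist Y (f x) (f y) = mdist X x y))"

definition gh_realizes :: "'c metric \<Rightarrow> 'c set \<Rightarrow> 'c set \<Rightarrow> 'a metric \<Rightarrow> 'b metric \<Rightarrow> bool" where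
  "gh_realizes Z X' Y' X Y \<longleftrightarrow> X' \<subseteq> mspace Z \<and> Y' \<subseteq> mspace Z \<and>
     isometric (submetric Z X') X \<and> isometric (submetric Z Y') Y"

text \<open>
  A definition cannot quantify over the type of the points of the ambient space \<open>Z\<close>.  Ambient
  spaces carried by a subset of \<open>'a + 'b\<close> suffice, since \<open>Z\<close> can be cut down to \<open>X' \<union> Y'\<close>;
  lemma \<open>gh_dist_le\<close> below shows that ambient spaces over other types do not lower the infimum.
\<close>

definition gh_dist :: "'a metric \<Rightarrow> 'b metric \<Rightarrow> ennreal" where
  "gh_dist X Y = Inf {ennreal r | r. 0 \<le> r \<and>
     (\<exists>(Z :: ('a + 'b) metric) X' Y'. gh_realizes Z X' Y' X Y \<and> hausdorff_dist Z X' Y' \<le> ennreal r)}"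

text \<open>The points of the cloud are not identified up to zero distance.\<close>

definition cloud :: "'b metric \<Rightarrow> 'a metric set" where
  "cloud B = {A. mspace A \<noteq> {} \<and> gh_dist A B < \<infinity>}"

text \<open>Meaningful for positive factors only, see \<open>mspace_scale_metric\<close> and \<open>mdist_scale_metric\<close>.\<close>

definition scale_metric :: "real \<Rightarrow> 'a metric \<Rightarrow> 'a metric" where
  "scale_metric c A = metric (mspace A, \<lambda>x y. c * mdist A x y)"

definition scaling_continuous_at :: "'a metric \<Rightarrow> real \<Rightarrow> bool" where
  "scaling_continuous_at A c0 \<longleftrightarrow>
     ((\<lambda>c. gh_dist (scale_metric c A) (scale_metric c0 A)) \<longlongrightarrow> 0) (at c0 within {0<..})"

definition scaling_continuous :: "'a metric \<Rightarrow> bool" where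
  "scaling_continuous A \<longleftrightarrow> (\<forall>c0>0. scaling_continuous_at A c0)"

lemma Metric_space_scale:
  assumes "c > 0"
  shows "Metric_space (mspace A) (\<lambda>x y. c * mdist A x y)"
proof
  fix x y z
  show "0 \<le> c * mdist A x y" using assms by simp
  show "c * mdist A x y = c * mdist A y x" by (simp add: mdist_commute)
  show "(c * mdist A x y = 0) = (x = y)" if "x \<in> mspace A" "y \<in> mspace A"
    using assms that by simp
  show "c * mdist A x z \<le> c * mdist A x y + c * mdist A y z"
    if "x \<in> mspace A" "y \<in> mspace A" "z \<in> mspace A"
    using mdist_triangle[OF that] assms by (simp flip: distrib_left)
qed

lemma mspace_scale_metric [simp]: "c > 0 \<Longrightarrow> mspace (scale_metric c A) = mspace A"
  unfolding scale_metric_def by (rule Metric_space.mspace_metric[OF Metric_space_scale])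

lemma mdist_scale_metric [simp]: "c > 0 \<Longrightarrow> mdist (scale_metric c A) x y = c * mdist A x y"
  unfolding scale_metric_def by (subst Metric_space.mdist_metric[OF Metric_space_scale]) auto

lemma isometric_sym: "isometric X Y \<Longrightarrow> isometric Y X"
  unfolding isometric_def
proof (elim exE conjE)
  fix f assume f: "bij_betw f (mspace X) (mspace Y)"
    and d: "\<forall>x\<in>mspace X. \<forall>y\<in>mspace X. mdist Y (f x) (f y) = mdist X x y"
  let ?g = "inv_into (mspace X) f"
  have "bij_betw ?g (mspace Y) (mspace X)" using f by (rule bij_betw_inv_into)
  moreover have "mdist X (?g x) (?g y) = mdist Y x y" if "x \<in> mspace Y" "y \<in> mspace Y" for x y
  proof -
    have "?g x \<in> mspace X" "?g y \<in> mspace X"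
      using that bij_betw_apply[OF bij_betw_inv_into[OF f]] by simp_all
    then have "mdist X (?g x) (?g y) = mdist Y (f (?g x)) (f (?g y))" using d by simp
    then show ?thesis using that by (simp add: bij_betw_inv_into_right[OF f])
  qed
  ultimately show "\<exists>g. bij_betw g (mspace Y) (mspace X) \<and>
     (\<forall>x\<in>mspace Y. \<forall>y\<in>mspace Y. mdist X (g x) (g y) = mdist Y x y)" by blast
qed

lemma isometric_trans:
  assumes "isometric X Y" "isometric Y Z"
  shows "isometric X Z"
proof -
  obtain f where f: "bij_betw f (mspace X) (mspace Y)"
    "\<And>x y. x \<in> mspace X \<Longrightarrow> y \<in> mspace X \<Longrightarrow> mdist Y (f x) (f y) = mdist X x y"
    using assms(1) unfolding isometric_def by blast
  obtain g where g: "bij_betw g (mspace Y) (mspace Z)"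
    "\<And>x y. x \<in> mspace Y \<Longrightarrow> y \<in> mspace Y \<Longrightarrow> mdist Z (g x) (g y) = mdist Y x y"
    using assms(2) unfolding isometric_def by blast
  have "bij_betw (g \<circ> f) (mspace X) (mspace Z)" using f(1) g(1) by (rule bij_betw_trans)
  moreover have "mdist Z ((g \<circ> f) x) ((g \<circ> f) y) = mdist X x y"
    if "x \<in> mspace X" "y \<in> mspace X" for x y
    using that f g by (simp add: bij_betw_apply[OF f(1)])
  ultimately show ?thesis unfolding isometric_def by blast
qed

lemma gh_dist_le:
  fixes X :: "'a metric" and Y :: "'b metric" and Z :: "'c metric"
  assumes r: "0 \<le> r" and gh: "gh_realizes Z X' Y' X Y"
    and hd: "hausdorff_dist Z X' Y' \<le> ennreal r"
  shows "gh_dist X Y \<le> ennreal r"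
proof -
  have sub: "X' \<subseteq> mspace Z" "Y' \<subseteq> mspace Z"
    and iso: "isometric (submetric Z X') X" "isometric (submetric Z Y') Y"
    using gh by (auto simp: gh_realizes_def)
  obtain f where f: "bij_betw f (mspace X) X'"
    using isometric_sym[OF iso(1)] sub unfolding isometric_def by (auto simp: Int_absorb2)
  obtain g where g: "bij_betw g (mspace Y) Y'"
    using isometric_sym[OF iso(2)] sub unfolding isometric_def by (auto simp: Int_absorb2)
  define h where "h = case_sum f g"
  define C where "C = Inl ` mspace X \<union> Inr ` {y \<in> mspace Y. g y \<notin> X'}"
  have h: "bij_betw h C (X' \<union> Y')"
  proof -
    have "inj_on h C"
    proof (rule inj_onI)
      fix u v assume uv: "u \<in> C" "v \<in> C" "h u = h v"
      have fX: "f x \<noteq> g y" if "x \<in> mspace X" "g y \<notin> X'" for x y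
        using bij_betw_apply[OF f that(1)] that(2) by auto
      show "u = v"
        using uv fX inj_onD[OF bij_betw_imp_inj_on[OF f]] inj_onD[OF bij_betw_imp_inj_on[OF g]]
        by (cases u; cases v) (auto 0 2 simp: h_def C_def dest: sym)
    qed
    moreover have "h ` C = X' \<union> Y'"
    proof
      show "h ` C \<subseteq> X' \<union> Y'" using f g unfolding h_def C_def bij_betw_def by auto
      show "X' \<union> Y' \<subseteq> h ` C"
      proof
        fix z assume z: "z \<in> X' \<union> Y'"
        show "z \<in> h ` C"
        proof (cases "z \<in> X'")
          case True
          then obtain x where "x \<in> mspace X" "z = f x" using f unfolding bij_betw_def by auto
          then have "z = h (Inl x)" "Inl x \<in> C" unfolding h_def C_def by auto
          then show ?thesis by blast
        next
          case False
          then obtain y where "y \<in> mspace Y" "z = g y" using g z unfolding bij_betw_def by auto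
          then have "z = h (Inr y)" "Inr y \<in> C" using False unfolding h_def C_def by auto
          then show ?thesis by blast
        qed
      qed
    qed
    ultimately show ?thesis by (simp add: bij_betw_def)
  qed
  have hZ: "h c \<in> mspace Z" if "c \<in> C" for c
    using bij_betw_apply[OF h that] sub by auto
  define d where "d = (\<lambda>u v. mdist Z (h u) (h v))"
  interpret W: Metric_space C d
  proof
    fix x y z
    show "0 \<le> d x y" "d x y = d y x" by (auto simp: d_def mdist_commute)
    show "(d x y = 0) = (x = y)" if "x \<in> C" "y \<in> C"
      using that hZ inj_onD[OF bij_betw_imp_inj_on[OF h]] by (auto simp: d_def)
    show "d x z \<le> d x y + d y z" if "x \<in> C" "y \<in> C" "z \<in> C"
      using that hZ by (auto simp: d_def intro: mdist_triangle)
  qed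
  define W where "W = metric (C, d)"
  have W [simp]: "mspace W = C" "mdist W = d" by (simp_all add: W_def)
  define pull where "pull = (\<lambda>S. {c \<in> C. h c \<in> S})"
  have im: "h ` pull S = S" if "S \<subseteq> X' \<union> Y'" for S
  proof -
    have "S \<subseteq> h ` C" using that h by (simp add: bij_betw_def)
    then show ?thesis by (auto simp: pull_def)
  qed
  have isoS: "isometric (submetric W (pull S)) (submetric Z S)" if S: "S \<subseteq> X' \<union> Y'" for S
    unfolding isometric_def
  proof (intro exI[of _ h] conjI ballI)
    have "S \<subseteq> mspace Z" "pull S \<subseteq> C" using S sub by (auto simp: pull_def)
    then show "bij_betw h (mspace (submetric W (pull S))) (mspace (submetric Z S))"
      using bij_betw_subset[OF h, of "pull S"] im[OF S] by (simp add: Int_absorb2)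
  qed (simp add: d_def)
  have "gh_realizes W (pull X') (pull Y') X Y"
    using isometric_trans[OF isoS iso(1)] isometric_trans[OF isoS iso(2)]
    by (auto simp: gh_realizes_def pull_def)
  moreover have "hausdorff_dist W (pull X') (pull Y') = hausdorff_dist Z (h ` pull X') (h ` pull Y')"
    by (simp add: hausdorff_dist_def d_def image_image)
  then have "hausdorff_dist W (pull X') (pull Y') \<le> ennreal r"
    using hd im by simp
  ultimately show ?thesis
    unfolding gh_dist_def using r by (intro Inf_lower) blast
qed

end

theory Submission
  imports Defs
begin

text \<open>
  The witness is the integer lattice \<open>\<int>\<^sup>n\<close>, which lies within finite Hausdorff distance of
  \<open>\<real>\<^sup>n\<close>, and continuity fails at the factor \<open>1\<close>.

  If the scaled lattice \<open>c\<int>\<^sup>n\<close> is Gromov--Hausdorff close to \<open>\<int>\<^sup>n\<close>, then matching nearby points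
  gives a self-map of the lattice under which every distance \<open>t\<close> becomes \<open>c t\<close> up to a small error,
  bounded uniformly in \<open>t\<close> (\<open>gh_dist_less_imp_almost_isometry\<close>).  Squared distances in the
  lattice are integers.  For \<open>c\<close> near \<open>1\<close>, the distances \<open>1\<close> and \<open>2\<close> are therefore preserved exactly.
  So the images of the points \<open>0, e, 2e, \<dots>\<close> on a coordinate axis make unit steps, and two
  successive steps always cover distance \<open>2\<close>: equality in the triangle inequality forces all steps
  to be the same vector (\<open>dist_straight_steps\<close>).  Hence \<open>0\<close> and \<open>k e\<close> have images at distance
  exactly \<open>k\<close>, so \<open>k - c k\<close> stays bounded as \<open>k\<close> grows, and \<open>c = 1\<close>.
\<close>

section \<open>Almost isometries from the Gromov--Hausdorff distance\<close>

text \<open>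
  Inside an ambient space realizing a distance below \<open>r\<close>, every point of the copy of \<open>X\<close> has a point
  of the copy of \<open>Y\<close> at distance less than \<open>r\<close>.  Moving both endpoints of a segment by less than
  \<open>r\<close> alters its length by at most \<open>2 * r\<close>.
\<close>

lemma gh_dist_less_imp_almost_isometry:
  assumes "gh_dist X Y < ennreal r"
  obtains f where "f \<in> mspace X \<rightarrow> mspace Y"
    and "\<And>x y. x \<in> mspace X \<Longrightarrow> y \<in> mspace X \<Longrightarrow>
           \<bar>mdist Y (f x) (f y) - mdist X x y\<bar> \<le> 2 * r"
proof -
  obtain s and Z :: "('a + 'b) metric" and X' Y' where s: "ennreal s < ennreal r" "0 \<le> s"
    and gh: "gh_realizes Z X' Y' X Y" and hd: "hausdorff_dist Z X' Y' \<le> ennreal s"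
    using assms unfolding gh_dist_def Inf_less_iff by blast
  have sub: "X' \<subseteq> mspace Z" "Y' \<subseteq> mspace Z"
    and iso: "isometric X (submetric Z X')" "isometric (submetric Z Y') Y"
    using gh isometric_sym by (auto simp: gh_realizes_def)
  obtain \<phi> where \<phi>: "\<phi> ` mspace X = X'"
    "\<And>x y. x \<in> mspace X \<Longrightarrow> y \<in> mspace X \<Longrightarrow> mdist Z (\<phi> x) (\<phi> y) = mdist X x y"
    using iso(1) sub unfolding isometric_def bij_betw_def by (auto simp: Int_absorb2)
  obtain \<psi> where \<psi>: "\<psi> ` Y' = mspace Y"
    "\<And>x y. x \<in> Y' \<Longrightarrow> y \<in> Y' \<Longrightarrow> mdist Y (\<psi> x) (\<psi> y) = mdist Z x y"
    using iso(2) sub unfolding isometric_def bij_betw_def by (auto simp: Int_absorb2)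
  have "\<exists>y\<in>Y'. mdist Z x y < r" if "x \<in> X'" for x
  proof -
    have "(INF y\<in>Y'. ennreal (mdist Z x y)) \<le> (SUP x\<in>X'. INF y\<in>Y'. ennreal (mdist Z x y))"
      using that by (rule SUP_upper)
    also have "\<dots> \<le> ennreal s"
      using hd by (simp add: hausdorff_dist_def)
    also note s(1)
    finally show ?thesis
      by (auto simp: INF_less_iff ennreal_less_iff)
  qed
  then obtain g where g: "\<And>x. x \<in> X' \<Longrightarrow> g x \<in> Y'" "\<And>x. x \<in> X' \<Longrightarrow> mdist Z x (g x) < r"
    by metis
  show thesis
  proof (rule that[of "\<psi> \<circ> g \<circ> \<phi>"])
    show "\<psi> \<circ> g \<circ> \<phi> \<in> mspace X \<rightarrow> mspace Y"
      using \<phi>(1) \<psi>(1) g(1) by auto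
    fix x y assume xy: "x \<in> mspace X" "y \<in> mspace X"
    define a b where "a = \<phi> x" and "b = \<phi> y"
    have ab: "a \<in> X'" "b \<in> X'"
      using xy \<phi>(1) by (auto simp: a_def b_def)
    then have Z: "a \<in> mspace Z" "b \<in> mspace Z" "g a \<in> mspace Z" "g b \<in> mspace Z"
      using sub g(1) by auto
    have "mdist Z (g a) (g b) \<le> mdist Z a (g a) + mdist Z a b + mdist Z b (g b)"
      using mdist_triangle[of "g a" Z a "g b"] mdist_triangle[of a Z b "g b"] Z
      by (simp add: mdist_commute)
    moreover have "mdist Z a b \<le> mdist Z a (g a) + mdist Z (g a) (g b) + mdist Z b (g b)"
      using mdist_triangle[of a Z "g a" b] mdist_triangle[of "g a" Z "g b" b] Z
      by (simp add: mdist_commute)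
    ultimately have "\<bar>mdist Z (g a) (g b) - mdist Z a b\<bar> \<le> 2 * r"
      using g(2)[OF ab(1)] g(2)[OF ab(2)] by linarith
    then show "\<bar>mdist Y ((\<psi> \<circ> g \<circ> \<phi>) x) ((\<psi> \<circ> g \<circ> \<phi>) y) - mdist X x y\<bar> \<le> 2 * r"
      using xy ab g(1) \<phi>(2) \<psi>(2) by (simp add: a_def b_def)
  qed
qed

section \<open>Sequences without turns\<close>

text \<open>
  Two successive steps of length \<open>d\<close> that together cover distance \<open>2 * d\<close> attain equality in the
  triangle inequality, so they are equal vectors; hence all steps agree with the first one.
\<close>

lemma dist_straight_steps:
  fixes u :: "nat \<Rightarrow> 'a :: real_inner"
  assumes one: "\<And>k. dist (u (Suc k)) (u k) = d"
    and two: "\<And>k. dist (u (Suc (Suc k))) (u k) = 2 * d"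
  shows "dist (u k) (u 0) = real k * d"
proof -
  define v where "v k = u (Suc k) - u k" for k
  have norm_v: "norm (v k) = d" for k
    using one by (simp add: v_def dist_norm)
  have "v (Suc k) = v k" for k
  proof (cases "d = 0")
    case True
    then show ?thesis using norm_v by (metis norm_eq_zero)
  next
    case False
    have "v (Suc k) + v k = u (Suc (Suc k)) - u k"
      by (simp add: v_def)
    then have "norm (v (Suc k) + v k) = norm (v (Suc k)) + norm (v k)"
      using two[of k] by (simp only: norm_v dist_norm mult_2)
    then have "d *\<^sub>R v k = d *\<^sub>R v (Suc k)"
      by (metis norm_triangle_eq norm_v)
    then show ?thesis using False by simp
  qed
  then have v: "v k = v 0" for k
    by (induction k) auto
  have "u k = u 0 + real k *\<^sub>R v 0"
  proof (induction k)
    case (Suc k)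
    have "u (Suc k) = u k + v k" by (simp add: v_def)
    then show ?case using Suc v[of k] by (simp add: algebra_simps)
  qed simp
  then show ?thesis by (simp add: dist_norm norm_v)
qed

section \<open>The integer lattice\<close>

definition int_lattice :: "(real ^ 'n) set" where
  "int_lattice = {x. \<forall>i. x $ i \<in> \<int>}"

lemma dist_int_lattice_power2_Ints:
  assumes "x \<in> int_lattice" "y \<in> int_lattice"
  shows "(dist x y)\<^sup>2 \<in> \<int>"
proof -
  have "(dist x y)\<^sup>2 = (\<Sum>i\<in>UNIV. (x $ i - y $ i)\<^sup>2)"
    unfolding dist_norm power2_norm_eq_inner inner_vec_def by (simp add: power2_eq_square)
  then show ?thesis
    using assms by (auto simp: int_lattice_def intro!: Ints_power Ints_diff)
qed

text \<open>
  Rounding coordinatewise to \<open>\<lfloor>x $ i\<rfloor>\<close> moves a point by at most \<open>n\<close>, since the norm is at most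
  the sum of the coordinates' absolute values.
\<close>

lemma int_lattice_coarsely_dense:
  fixes x :: "real ^ 'n"
  obtains y where "y \<in> int_lattice" "dist y x \<le> real CARD('n)"
proof
  let ?y = "(\<chi> i. of_int \<lfloor>x $ i\<rfloor>) :: real ^ 'n"
  show "?y \<in> int_lattice" by (simp add: int_lattice_def)
  have "dist ?y x \<le> (\<Sum>i\<in>UNIV. \<bar>(?y - x) $ i\<bar>)"
    unfolding dist_norm by (rule norm_le_l1_cart)
  also have "\<dots> \<le> (\<Sum>i\<in>(UNIV :: 'n set). 1)"
  proof (rule sum_mono)
    fix i :: 'n
    show "\<bar>(?y - x) $ i\<bar> \<le> 1"
      using floor_correct[of "x $ i"] by simp linarith
  qed
  finally show "dist ?y x \<le> real CARD('n)" by simp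
qed

abbreviation int_lattice_metric :: "(real ^ 'n) metric" where
  "int_lattice_metric \<equiv> submetric euclidean_metric int_lattice"

lemma int_lattice_in_cloud:
  "(int_lattice_metric :: (real ^ 'n) metric) \<in> cloud (euclidean_metric :: (real ^ 'n) metric)"
proof -
  let ?E = "euclidean_metric :: (real ^ 'n) metric" and ?r = "real CARD('n)"
  have "isometric M M" for M :: "(real ^ 'n) metric"
    unfolding isometric_def by (intro exI[of _ id]) auto
  moreover have "submetric ?E UNIV = ?E"
    by (metis mspace_euclidean_metric submetric_mspace)
  ultimately have "gh_realizes ?E int_lattice UNIV (int_lattice_metric :: (real ^ 'n) metric) ?E"
    by (simp add: gh_realizes_def)
  moreover have "hausdorff_dist ?E int_lattice UNIV \<le> ennreal ?r"
    unfolding hausdorff_dist_def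
  proof (intro max.boundedI SUP_least)
    fix x :: "real ^ 'n"
    have "(INF y. ennreal (mdist ?E x y)) \<le> ennreal (mdist ?E x x)"
      by (rule INF_lower) simp
    then show "(INF y. ennreal (mdist ?E x y)) \<le> ennreal ?r"
      by simp
    obtain y where y: "y \<in> int_lattice" "dist y x \<le> ?r"
      by (rule int_lattice_coarsely_dense)
    have "(INF y\<in>int_lattice. ennreal (mdist ?E y x)) \<le> ennreal (mdist ?E y x)"
      using y(1) by (rule INF_lower)
    also have "\<dots> \<le> ennreal ?r" using y(2) by (simp add: ennreal_leI)
    finally show "(INF y\<in>int_lattice. ennreal (mdist ?E y x)) \<le> ennreal ?r" .
  qed
  ultimately have "gh_dist (int_lattice_metric :: (real ^ 'n) metric) ?E \<le> ennreal ?r"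
    by (intro gh_dist_le) auto
  also have "\<dots> < \<infinity>" by simp
  finally have "gh_dist (int_lattice_metric :: (real ^ 'n) metric) ?E < \<infinity>" .
  moreover have "(0 :: real ^ 'n) \<in> int_lattice" by (simp add: int_lattice_def)
  ultimately show ?thesis unfolding cloud_def by auto
qed

section \<open>Rigidity of the lattice under scaling\<close>

text \<open>
  The squares of the two numbers are integers at distance less than \<open>1\<close>, hence equal: by the bounds
  on \<open>a\<close> and \<open>m\<close>, the difference of the squares is at most \<open>21/5 * 1/5 < 1\<close>.
\<close>

lemma eq_of_power2_Ints_close:
  fixes a m :: real
  assumes "a\<^sup>2 \<in> \<int>" "m\<^sup>2 \<in> \<int>" "0 \<le> a" "0 \<le> m" "m \<le> 2" "\<bar>a - m\<bar> \<le> 1 / 5"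
  shows "a = m"
proof -
  have "\<bar>a\<^sup>2 - m\<^sup>2\<bar> = \<bar>a - m\<bar> * (a + m)"
    using assms(3,4) by (simp add: power2_eq_square square_diff_square_factored abs_mult)
  also have "\<dots> \<le> 1 / 5 * (21 / 5)"
    using assms by (intro mult_mono) linarith+
  also have "\<dots> < 1" by simp
  finally have "a\<^sup>2 = m\<^sup>2"
    using assms(1,2) by (metis Ints_eq_abs_less1)
  then show ?thesis using assms(3,4) by simp
qed

text \<open>
  The bound \<open>1/10\<close> on the distortion together with \<open>\<bar>c - 1\<bar> \<le> 1/20\<close> keeps the images of segments of
  length \<open>1\<close> and \<open>2\<close> within \<open>1/5\<close> of their original lengths, where no other lattice distance lies.
\<close>

lemma int_lattice_almost_homothety_trivial:
  fixes f :: "real ^ 'n \<Rightarrow> real ^ 'n"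
  assumes f: "f \<in> int_lattice \<rightarrow> int_lattice"
    and close: "\<And>x y. x \<in> int_lattice \<Longrightarrow> y \<in> int_lattice \<Longrightarrow>
                  \<bar>dist (f x) (f y) - c * dist x y\<bar> \<le> 1 / 10"
    and c: "\<bar>c - 1\<bar> \<le> 1 / 20"
  shows "c = 1"
proof (rule ccontr)
  assume "c \<noteq> 1"
  fix i :: 'n
  define e where "e k = (axis i (real k) :: real ^ 'n)" for k
  have e: "e k \<in> int_lattice" for k
    by (simp add: e_def int_lattice_def axis_def)
  have dist_e: "dist (e j) (e k) = \<bar>real j - real k\<bar>" for j k
  proof -
    have "e j - e k = axis i (real j - real k)"
      by (simp add: e_def axis_def vec_eq_iff)
    then show ?thesis unfolding dist_norm norm_eq_sqrt_inner by (simp add: inner_axis_axis)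
  qed
  have fe: "\<bar>dist (f (e j)) (f (e k)) - c * \<bar>real j - real k\<bar>\<bar> \<le> 1 / 10" for j k
    using close[OF e e] by (simp add: dist_e)
  have Z: "(dist (f (e j)) (f (e k)))\<^sup>2 \<in> \<int>" for j k
    using f e by (intro dist_int_lattice_power2_Ints) auto
  have one: "dist (f (e (Suc k))) (f (e k)) = 1" for k
  proof (rule eq_of_power2_Ints_close[OF Z])
    have "\<bar>real (Suc k) - real k\<bar> = 1" by simp
    from fe[of "Suc k" k, unfolded this] c
    show "\<bar>dist (f (e (Suc k))) (f (e k)) - 1\<bar> \<le> 1 / 5"
      by linarith
  qed auto
  have two: "dist (f (e (Suc (Suc k)))) (f (e k)) = 2" for k
  proof (rule eq_of_power2_Ints_close[OF Z])
    have "\<bar>real (Suc (Suc k)) - real k\<bar> = 2" by simp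
    from fe[of "Suc (Suc k)" k, unfolded this] c
    show "\<bar>dist (f (e (Suc (Suc k)))) (f (e k)) - 2\<bar> \<le> 1 / 5"
      by linarith
  qed auto
  have "dist (f (e k)) (f (e 0)) = real k" for k
    using dist_straight_steps[of "\<lambda>k. f (e k)" 1 k] one two by simp
  then have "\<bar>real k - c * real k\<bar> \<le> 1 / 10" for k
    using fe[of k 0] by simp
  moreover have "real k - c * real k = real k * (1 - c)" for k
    by (simp add: algebra_simps)
  ultimately have bound: "real k * \<bar>1 - c\<bar> \<le> 1 / 10" for k
    by (metis abs_mult abs_of_nat)
  obtain k where "1 < real k * \<bar>1 - c\<bar>"
    using reals_Archimedean3[of "\<bar>1 - c\<bar>"] \<open>c \<noteq> 1\<close> by auto
  then show False using bound[of k] by linarith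
qed

text \<open>
  Continuity at \<open>1\<close> would bring some \<open>c \<int>\<^sup>n\<close> with \<open>c \<noteq> 1\<close> so close to \<open>\<int>\<^sup>n\<close> that the rigidity of the
  lattice applies; a gap below \<open>1/20\<close> gives distortion at most \<open>1/10\<close>.
\<close>

lemma int_lattice_not_scaling_continuous_at_1:
  "\<not> scaling_continuous_at (int_lattice_metric :: (real ^ 'n) metric) 1"
proof
  let ?A = "int_lattice_metric :: (real ^ 'n) metric"
  assume "scaling_continuous_at ?A 1"
  then have "\<forall>\<^sub>F c in at 1 within {0<..}.
      gh_dist (scale_metric c ?A) (scale_metric 1 ?A) < ennreal (1 / 20)"
    unfolding scaling_continuous_at_def by (rule order_tendstoD) simp
  then obtain \<delta> where \<delta>: "\<delta> > 0"
    "\<And>c. c > 0 \<Longrightarrow> c \<noteq> 1 \<Longrightarrow> dist c 1 < \<delta> \<Longrightarrow>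
       gh_dist (scale_metric c ?A) (scale_metric 1 ?A) < ennreal (1 / 20)"
    unfolding eventually_at by auto
  define c where "c = 1 + min (\<delta> / 2) (1 / 20)"
  have c: "c > 0" "c \<noteq> 1" "dist c 1 < \<delta>" "\<bar>c - 1\<bar> \<le> 1 / 20"
    using \<delta>(1) by (auto simp: c_def dist_real_def min_def)
  obtain f where "f \<in> mspace (scale_metric c ?A) \<rightarrow> mspace (scale_metric 1 ?A)"
    "\<And>x y. x \<in> mspace (scale_metric c ?A) \<Longrightarrow> y \<in> mspace (scale_metric c ?A) \<Longrightarrow>
       \<bar>mdist (scale_metric 1 ?A) (f x) (f y) - mdist (scale_metric c ?A) x y\<bar> \<le> 2 * (1 / 20)"
    using gh_dist_less_imp_almost_isometry[OF \<delta>(2)[OF c(1-3)]] by blast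
  then have "c = 1"
    using c(1,4) by (intro int_lattice_almost_homothety_trivial[of f c]) auto
  then show False using c(2) by simp
qed

theorem corollary4:
  shows "\<exists>A :: (real ^ 'n) metric.
           A \<in> cloud (euclidean_metric :: (real ^ 'n) metric) \<and> \<not> scaling_continuous A"
  using int_lattice_in_cloud int_lattice_not_scaling_continuous_at_1
  unfolding scaling_continuous_def by (blast intro: zero_less_one)

end
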